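(* Consider an instance of the multiple gradual cover location problem (MGCLP) with finite set of potential facility locations $I$, finite set of customers $J$, coverages $f_{ij}\in[0,1]$ ($i\in I$, $j\in J$), customer weights $w_j\ge 0$, parameter $\theta\in[0,1]$, and a positive integer $K$, where solutions are required to satisfy the ordering constraint. Let $i\in I$, let $k\in\{1,\dots,K\}$, and let $\mathcal I^k=\{i^{k'}:1\le k'\le k\}$ be the set of the first $k$ facilities at location $i$. Let $UB^{K-k}$ denote an upper bound on the objective value of any solution with $K-k$ open facilities, and let $z$ be the value of a feasible solution of the MGCLP. If $$W(\theta,\mathcal I^k)+UB^{K-k}<z,$$ then in any optimal solution no facilities are opened in positions $k$ to $K$ at location $i$, i.e. none of $i^k,i^{k+1},\dots,i^K$ is opened.
   Context: Let $I$ be a finite nonempty set of potential facility locations, $J$ a finite set of customers, $f_{ij}\in[0,1]$ the coverage customer $j\in J$ receives from a facility at location $i\in I$, $w_j\ge 0$ the weight of customer $j$, $\theta\in[0,1]$, and $K$ a positive integer. Co-location (opening several facilities at one location) is allowed: let $I^K=I\times\{1,\dots,K\}$, whose element $(i,k)$, also written $i^k$, is the $k$-th facility (copy, or position) at location $i$; every copy $i^k$ has the same coverages $f_{ij}$ as location $i$. For $I'\subseteq I^K$ and $j\in J$, the joint coverage function is $$p_j(\theta,I')=\theta\Big(\max_{(i,k)\in I'} f_{ij}\Big)+(1-\theta)\Big(1-\prod_{(i,k)\in I'}(1-f_{ij})\Big),$$ with the maximum over the empty set taken to be $0$ and the empty product taken to be $1$. The objective function is $W(\theta,I')=\sum_{j\in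 J}w_j\,p_j(\theta,I')$. The MGCLP is the problem of maximizing $W(\theta,I')$ over all $I'\subseteq I^K$ with $|I'|\le K$. A (feasible) solution is such a set $I'$; its elements are the opened facilities; its value is $W(\theta,I')$; it is optimal if it attains the maximum. Ordering constraint (symmetry breaking, assumed throughout): solutions $I'$ satisfy, for every location $i$ and $1\le k\le K-1$, that if $(i,k+1)\in I'$ then $(i,k)\in I'$. This does not change the optimal value. "$UB^{K-k}$ is an upper bound on the objective value of any solution with $K-k$ open facilities" means $W(\theta,S)\le UB^{K-k}$ for every $S\subseteq I^K$ with $|S|=K-k$. *)

theory Defs
  imports Complex_Main
begin

text \<open>
  A facility is a pair \<open>(i, k)\<close>, the \<open>k\<close>-th copy at location \<open>i\<close>, with positions counted from 1.
\<close>

definition facilities :: "'i set \<Rightarrow> nat \<Rightarrow> ('i \<times> nat) set" where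
  "facilities I K = I \<times> {1..K}"

definition first_copies :: "'i \<Rightarrow> nat \<Rightarrow> ('i \<times> nat) set" where
  "first_copies i k = {(i, k') | k'. 1 \<le> k' \<and> k' \<le> k}"

definition max_coverage :: "('i \<Rightarrow> 'j \<Rightarrow> real) \<Rightarrow> ('i \<times> nat) set \<Rightarrow> 'j \<Rightarrow> real" where
  "max_coverage f S j = (if S = {} then 0 else Max ((\<lambda>(i, k). f i j) ` S))"

definition joint_coverage ::
    "('i \<Rightarrow> 'j \<Rightarrow> real) \<Rightarrow> real \<Rightarrow> ('i \<times> nat) set \<Rightarrow> 'j \<Rightarrow> real" where
  "joint_coverage f \<theta> S j =
     \<theta> * max_coverage f S j + (1 - \<theta>) * (1 - (\<Prod>(i, k)\<in>S. 1 - f i j))"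

definition objective ::
    "'j set \<Rightarrow> ('i \<Rightarrow> 'j \<Rightarrow> real) \<Rightarrow> ('j \<Rightarrow> real) \<Rightarrow> real \<Rightarrow> ('i \<times> nat) set \<Rightarrow> real" where
  "objective J f w \<theta> S = (\<Sum>j\<in>J. w j * joint_coverage f \<theta> S j)"

definition ordered :: "'i set \<Rightarrow> nat \<Rightarrow> ('i \<times> nat) set \<Rightarrow> bool" where
  "ordered I K S \<longleftrightarrow>
     (\<forall>i\<in>I. \<forall>k. 1 \<le> k \<and> k \<le> K - 1 \<longrightarrow> (i, k + 1) \<in> S \<longrightarrow> (i, k) \<in> S)"

text \<open>Solutions are understood to satisfy the symmetry-breaking ordering constraint.\<close>

definition mgclp_solution :: "'i set \<Rightarrow> nat \<Rightarrow> ('i \<times> nat) set \<Rightarrow> bool" where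
  "mgclp_solution I K S \<longleftrightarrow> S \<subseteq> facilities I K \<and> card S \<le> K \<and> ordered I K S"

definition mgclp_optimal ::
    "'i set \<Rightarrow> 'j set \<Rightarrow> ('i \<Rightarrow> 'j \<Rightarrow> real) \<Rightarrow> ('j \<Rightarrow> real) \<Rightarrow> real \<Rightarrow> nat \<Rightarrow>
     ('i \<times> nat) set \<Rightarrow> bool" where
  "mgclp_optimal I J f w \<theta> K S \<longleftrightarrow> is_arg_max (objective J f w \<theta>) (mgclp_solution I K) S"

text \<open>
  The bound ranges over all sets of \<open>m\<close> facilities, whether or not they are ordered.
\<close>

definition upper_bound ::
    "'i set \<Rightarrow> 'j set \<Rightarrow> ('i \<Rightarrow> 'j \<Rightarrow> real) \<Rightarrow> ('j \<Rightarrow> real) \<Rightarrow> real \<Rightarrow> nat \<Rightarrow>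
     nat \<Rightarrow> real \<Rightarrow> bool" where
  "upper_bound I J f w \<theta> K m UB \<longleftrightarrow>
     (\<forall>S. S \<subseteq> facilities I K \<and> card S = m \<longrightarrow> objective J f w \<theta> S \<le> UB)"

end

theory Submission
  imports Defs
begin

text \<open>
  The objective is monotone and subadditive in the set of opened facilities. Per customer, the
  maximum of a union is the larger of two nonnegative maxima, and the uncovered fraction
  \<open>\<Prod>(1 - f)\<close> of a disjoint union is a product \<open>p q\<close> with \<open>p\<close> and \<open>q\<close> in \<open>[0,1]\<close>, for which
  \<open>(1 - p q) \<le> (1 - p) + (1 - q)\<close>.

  If an optimal solution \<open>S\<close> opened a copy of \<open>i\<close> in a position at least \<open>k\<close>, the ordering
  constraint would put all of the first \<open>k\<close> copies \<open>A\<close> into \<open>S\<close>. The rest \<open>S - A\<close> has at most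
  \<open>K - k\<close> elements, so it can be padded to exactly \<open>K - k\<close> facilities, which by monotonicity does
  not lower its value. Subadditivity then bounds the value of \<open>S\<close> by the value of \<open>A\<close> plus
  \<open>UB\<close>, which is less than \<open>z\<close>, so \<open>S\<close> is not optimal.
\<close>

lemma max_coverage_nonneg:
  assumes "finite S" and "\<And>i k. (i, k) \<in> S \<Longrightarrow> 0 \<le> f i j"
  shows "0 \<le> max_coverage f S j"
proof (cases "S = {}")
  case False
  then obtain i k where "(i, k) \<in> S" by auto
  have "f i j \<le> Max ((\<lambda>(i, k). f i j) ` S)"
    using assms(1) \<open>(i, k) \<in> S\<close> by (intro Max_ge) force+
  moreover have "0 \<le> f i j" using assms(2) \<open>(i, k) \<in> S\<close> .
  ultimately show ?thesis using False unfolding max_coverage_def by simp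
qed (simp add: max_coverage_def)

text \<open>
  Nonnegative coverages make the default value 0 for the empty set neutral for the maximum.
\<close>

lemma max_coverage_Un:
  assumes "finite S" and "finite T"
    and "\<And>i k. (i, k) \<in> S \<union> T \<Longrightarrow> 0 \<le> f i j"
  shows "max_coverage f (S \<union> T) j = max (max_coverage f S j) (max_coverage f T j)"
proof (cases "S = {} \<or> T = {}")
  case True
  have "0 \<le> max_coverage f S j" "0 \<le> max_coverage f T j"
    using assms by (auto intro!: max_coverage_nonneg)
  moreover have "max_coverage f {} j = 0" by (simp add: max_coverage_def)
  ultimately show ?thesis using True by (auto simp: max_absorb1 max_absorb2)
next
  case False
  then show ?thesis
    using assms(1,2) by (simp add: max_coverage_def image_Un Max_Un)
qed

lemma joint_coverage_Un_disjoint: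
  assumes "finite S" and "finite T" and "S \<inter> T = {}" and "\<theta> \<in> {0..1}"
    and cov: "\<And>i k. (i, k) \<in> S \<union> T \<Longrightarrow> f i j \<in> {0..1}"
  shows joint_coverage_mono: "joint_coverage f \<theta> T j \<le> joint_coverage f \<theta> (S \<union> T) j"
    and joint_coverage_subadditive:
      "joint_coverage f \<theta> (S \<union> T) j \<le> joint_coverage f \<theta> S j + joint_coverage f \<theta> T j"
proof -
  define p where "p U = (\<Prod>(i, k)\<in>U. 1 - f i j)" for U :: "('a \<times> nat) set"
  define m where "m U = max_coverage f U j" for U
  have jc: "joint_coverage f \<theta> U j = \<theta> * m U + (1 - \<theta>) * (1 - p U)" for U
    by (simp add: joint_coverage_def p_def m_def)
  have p: "0 \<le> p U" "p U \<le> 1" if "U \<subseteq> S \<union> T" for U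
    unfolding p_def using that cov by (fastforce intro!: prod_nonneg prod_le_1)+
  have p_Un: "p (S \<union> T) = p S * p T"
    unfolding p_def using assms(1-3) by (rule prod.union_disjoint)
  have m_Un: "m (S \<union> T) = max (m S) (m T)"
    unfolding m_def using assms(1,2) cov by (intro max_coverage_Un) auto
  have m: "0 \<le> m S" "0 \<le> m T"
    unfolding m_def using assms(1,2) cov by (auto intro!: max_coverage_nonneg)
  have "p S * p T \<le> p T" using p[of S] p[of T] by (simp add: mult_left_le_one_le)
  then show "joint_coverage f \<theta> T j \<le> joint_coverage f \<theta> (S \<union> T) j"
    unfolding jc p_Un m_Un using assms(4) by (intro add_mono mult_left_mono) auto
  have "0 \<le> (1 - p S) * (1 - p T)" using p[of S] p[of T] by simp
  then have "1 - p S * p T \<le> (1 - p S) + (1 - p T)" by (simp add: algebra_simps)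
  then have "joint_coverage f \<theta> (S \<union> T) j
      \<le> \<theta> * (m S + m T) + (1 - \<theta>) * ((1 - p S) + (1 - p T))"
    unfolding jc p_Un m_Un using m assms(4) by (intro add_mono mult_left_mono) auto
  then show "joint_coverage f \<theta> (S \<union> T) j \<le> joint_coverage f \<theta> S j + joint_coverage f \<theta> T j"
    unfolding jc by (simp add: algebra_simps)
qed

lemma objective_Un_disjoint:
  assumes "finite S" and "finite T" and "S \<inter> T = {}" and "\<theta> \<in> {0..1}"
    and "\<And>i k j. (i, k) \<in> S \<union> T \<Longrightarrow> j \<in> J \<Longrightarrow> f i j \<in> {0..1}"
    and "\<And>j. j \<in> J \<Longrightarrow> 0 \<le> w j"
  shows objective_mono: "objective J f w \<theta> T \<le> objective J f w \<theta> (S \<union> T)"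
    and objective_subadditive:
      "objective J f w \<theta> (S \<union> T) \<le> objective J f w \<theta> S + objective J f w \<theta> T"
proof -
  show "objective J f w \<theta> T \<le> objective J f w \<theta> (S \<union> T)"
    unfolding objective_def
    using assms by (intro sum_mono mult_left_mono joint_coverage_mono) auto
  have "objective J f w \<theta> (S \<union> T)
      \<le> (\<Sum>j\<in>J. w j * (joint_coverage f \<theta> S j + joint_coverage f \<theta> T j))"
    unfolding objective_def
    using assms by (intro sum_mono mult_left_mono joint_coverage_subadditive) auto
  then show "objective J f w \<theta> (S \<union> T) \<le> objective J f w \<theta> S + objective J f w \<theta> T"
    unfolding objective_def by (simp add: distrib_left sum.distrib)
qed

lemma ordered_first_copies_subset:
  assumes "ordered I K S" and "i \<in> I" and "(i, k') \<in> S" and "k \<le> k'" and "k' \<le> K"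
  shows "first_copies i k \<subseteq> S"
proof -
  have "(i, m) \<in> S" if "1 \<le> m" and "m \<le> k'" for m
    using that(2,1)
  proof (induction rule: inc_induct)
    case base
    show ?case using assms(3) .
  next
    case (step n)
    then have "(i, n + 1) \<in> S" by simp
    moreover have "n \<le> K - 1" using step.hyps assms(5) by simp
    ultimately show ?case
      using assms(1,2) step.prems unfolding ordered_def by blast
  qed
  then show ?thesis using assms(4) by (auto simp: first_copies_def)
qed

lemma card_first_copies: "card (first_copies i k) = k"
proof -
  have "first_copies i k = Pair i ` {1..k}" by (auto simp: first_copies_def)
  then show ?thesis by (simp add: card_image inj_on_def)
qed

theorem theorem2:
  fixes I :: "'i set" and J :: "'j set"
    and f :: "'i \<Rightarrow> 'j \<Rightarrow> real" and w :: "'j \<Rightarrow> real"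
    and \<theta> UB z :: real and K k :: nat and i :: 'i
  assumes "finite I" and "I \<noteq> {}" and "finite J"
    and "\<And>i j. i \<in> I \<Longrightarrow> j \<in> J \<Longrightarrow> f i j \<in> {0..1}"
    and "\<And>j. j \<in> J \<Longrightarrow> w j \<ge> 0"
    and "\<theta> \<in> {0..1}"
    and "K \<ge> 1"
    and "i \<in> I"
    and "k \<in> {1..K}"
    and "upper_bound I J f w \<theta> K (K - k) UB"
    and "\<exists>S. mgclp_solution I K S \<and> z = objective J f w \<theta> S"
    and "objective J f w \<theta> (first_copies i k) + UB < z"
  shows "\<forall>S. mgclp_optimal I J f w \<theta> K S \<longrightarrow> (\<forall>k'\<in>{k..K}. (i, k') \<notin> S)"
proof (intro allI impI ballI notI)
  fix S k'
  assume opt: "mgclp_optimal I J f w \<theta> K S" and k': "k' \<in> {k..K}" "(i, k') \<in> S"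
  define A where "A = first_copies i k"
  have S: "S \<subseteq> facilities I K" "card S \<le> K" "ordered I K S"
    and best: "\<And>T. mgclp_solution I K T \<Longrightarrow> objective J f w \<theta> T \<le> objective J f w \<theta> S"
    using opt by (auto simp: mgclp_optimal_def is_arg_max_linorder mgclp_solution_def)
  have fin: "finite (facilities I K)" using assms(1) by (simp add: facilities_def)
  have "finite S" using S(1) fin finite_subset by blast
  have "A \<subseteq> S"
    unfolding A_def using S(3) assms(8) k' by (intro ordered_first_copies_subset) auto
  then have "finite A" using \<open>finite S\<close> finite_subset by blast
  have cov: "f i' j \<in> {0..1}" if "(i', l) \<in> facilities I K" "j \<in> J" for i' l j
    using assms(4) that by (auto simp: facilities_def)

  \<comment> \<open>\<open>UB\<close> speaks only of sets with exactly \<open>K - k\<close> elements, so \<open>S - A\<close> has to be padded; the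
    \<open>K\<close> copies of a single location already leave room for this.\<close>
  have "card (S - A) \<le> K - k"
    using S(2) \<open>finite A\<close> \<open>A \<subseteq> S\<close> by (simp add: card_Diff_subset A_def card_first_copies)
  moreover have "K - k \<le> card (facilities I K)"
  proof -
    have "1 \<le> card I" using assms(1,2) by (simp add: Suc_le_eq card_gt_0_iff)
    then have "1 * K \<le> card I * K" by (rule mult_le_mono1)
    then have "K - k \<le> card I * K" by linarith
    then show ?thesis by (simp add: facilities_def card_cartesian_product)
  qed
  ultimately obtain B where B: "S - A \<subseteq> B" "B \<subseteq> facilities I K" "card B = K - k"
    using exists_subset_between[of "S - A" "K - k" "facilities I K"] S(1) fin by blast
  have "finite B" using B(2) fin finite_subset by blast

  have "objective J f w \<theta> S = objective J f w \<theta> (A \<union> (S - A))"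
    using \<open>A \<subseteq> S\<close> by (simp add: Un_absorb1)
  also have "\<dots> \<le> objective J f w \<theta> A + objective J f w \<theta> (S - A)"
    using \<open>finite A\<close> \<open>finite S\<close> \<open>A \<subseteq> S\<close> S(1) assms(5,6) cov
    by (intro objective_subadditive) blast+
  also have "objective J f w \<theta> (S - A) \<le> objective J f w \<theta> ((B - (S - A)) \<union> (S - A))"
    using \<open>finite B\<close> \<open>finite S\<close> B(2) S(1) assms(5,6) cov
    by (intro objective_mono) blast+
  also have "(B - (S - A)) \<union> (S - A) = B" using B(1) by blast
  also have "objective J f w \<theta> B \<le> UB"
    using assms(10) B(2,3) by (simp add: upper_bound_def)
  also have "objective J f w \<theta> A + UB < z" using assms(12) by (simp add: A_def)
  also have "z \<le> objective J f w \<theta> S" using assms(11) best by blast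
  finally show False by simp
qed

end
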